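(* For each positive integer $k$ there exists a $(2k+1)\times(2k+1)$ Seidel matrix of a tournament having $\pm\sqrt{4k-1}\,i$ as eigenvalues.
   Context: A tournament of order $m$ is a digraph on $\{1,\dots,m\}$ with exactly one of the arcs $ij$, $ji$ for each pair $i\ne j$. Its Seidel matrix $S=[s_{ij}]$ is the $m\times m$ skew-symmetric matrix with zero diagonal, $s_{ij}=1$ if $ij$ is an arc and $s_{ij}=-1$ otherwise. *)

theory Defs
  imports
    Complex_Main
    "Graph_Theory.Pair_Digraph"
    "Jordan_Normal_Form.Char_Poly"
begin

definition tournament :: "nat \<Rightarrow> nat pair_pre_digraph \<Rightarrow> bool" where
  "tournament m T \<longleftrightarrow>
     pair_digraph T \<and> pverts T = {1..m} \<and>
     (\<forall>i\<in>{1..m}. \<forall>j\<in>{1..m}. i \<noteq> j \<longrightarrow> ((i, j) \<in> parcs T) \<noteq> ((j, i) \<in> parcs T))"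

text \<open>Rows and columns of a matrix are numbered from 0, vertices from 1: row \<open>i\<close> (column \<open>j\<close>)
  belongs to vertex \<open>Suc i\<close> (\<open>Suc j\<close>).\<close>

definition seidel_matrix :: "nat \<Rightarrow> nat pair_pre_digraph \<Rightarrow> int mat" where
  "seidel_matrix m T = mat m m (\<lambda>(i, j).
     if i = j then 0 else if (Suc i, Suc j) \<in> parcs T then 1 else -1)"

end

(* Blowing up a vertex of the cyclic triangle into a regular tournament C of order m = 2k - 1 gives a
   tournament C -> a -> b -> C. The partition of the vertices into C, {a}, {b} is equitable for the
   Seidel matrix because C is regular, and the nonzero eigenvalues of the 3 by 3 quotient matrix
   satisfy z^2 = -(m*1 + 1*1 + 1*m) = -(4k - 1). *)

theory Submission
  imports Defs
begin

text \<open>With vertices numbered from 0, \<open>C\<close> is \<open>{..<m}\<close>, \<open>a = m\<close> and \<open>b = m + 1\<close>.\<close>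

definition upward_arc :: "nat \<Rightarrow> nat \<Rightarrow> nat \<Rightarrow> bool" where
  "upward_arc m i j \<longleftrightarrow> (if j < m then odd (i + j) else j = m \<or> i = m)"

text \<open>Downward arcs are the complement of the upward ones, so exactly one of two opposite arcs
  is present by construction. For odd \<open>m\<close>, distinct \<open>i\<close>, \<open>j\<close>
  in \<open>C\<close> have the arc from \<open>i\<close> to \<open>j\<close> iff
  \<open>(j - i) mod m\<close> is odd, so \<open>C\<close> is a circulant and hence regular
  tournament.\<close>

definition blowup_arc :: "nat \<Rightarrow> nat \<Rightarrow> nat \<Rightarrow> bool" where
  "blowup_arc m i j \<longleftrightarrow> i < j \<and> upward_arc m i j \<or> j < i \<and> \<not> upward_arc m j i"

definition triangle_blowup :: "nat \<Rightarrow> nat pair_pre_digraph" where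
  "triangle_blowup m = \<lparr>pverts = {1..m + 2},
     parcs = {(i, j). i \<in> {1..m + 2} \<and> j \<in> {1..m + 2} \<and> blowup_arc m (i - 1) (j - 1)}\<rparr>"

definition blowup_sign :: "nat \<Rightarrow> nat \<Rightarrow> nat \<Rightarrow> int" where
  "blowup_sign m i j = (if i = j then 0 else if blowup_arc m i j then 1 else -1)"

lemma tournament_triangle_blowup: "tournament (m + 2) (triangle_blowup m)"
proof -
  let ?T = "triangle_blowup m"
  have "pair_digraph ?T"
  proof
    show "finite (parcs ?T)"
      by (rule finite_subset[of _ "{1..m + 2} \<times> {1..m + 2}"]) (auto simp: triangle_blowup_def)
  qed (auto simp: triangle_blowup_def blowup_arc_def)
  then show ?thesis
    by (auto simp: tournament_def triangle_blowup_def blowup_arc_def)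
qed

lemma seidel_matrix_triangle_blowup:
  "seidel_matrix (m + 2) (triangle_blowup m) = mat (m + 2) (m + 2) (\<lambda>(i, j). blowup_sign m i j)"
  by (rule eq_matI) (auto simp: seidel_matrix_def triangle_blowup_def blowup_sign_def)

text \<open>Within \<open>C\<close> the signs of row \<open>p\<close> alternate on each side of the
  diagonal, so partial sums stay bounded and depend only on parities. Stating this for every prefix
  is what lets the induction go through.\<close>

lemma sum_blowup_sign_prefix:
  assumes "p < m" "r \<le> m"
  shows "(\<Sum>j<r. blowup_sign m p j) =
    (if r \<le> p then (if odd r then (if even p then 1 else -1) else 0)
     else of_bool (even (r + p)) - of_bool (odd p))"
  using assms(2)
proof (induction r)
  case (Suc r)
  then show ?case
    using assms(1)
    by (auto simp: blowup_sign_def blowup_arc_def upward_arc_def not_le le_Suc_eq)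
qed simp

lemma sum_blowup_sign_regular:
  assumes "odd m" "p < m"
  shows "(\<Sum>j<m. blowup_sign m p j) = 0"
  using assms by (simp add: sum_blowup_sign_prefix)

text \<open>Only the square of \<open>z\<close> is prescribed, so the lemma serves both signs of the
  eigenvalue.\<close>

lemma eigenvalue_triangle_blowup:
  fixes z :: complex
  assumes "odd m" and z: "z\<^sup>2 = - (2 * of_nat m + 1)"
  shows "eigenvalue (map_mat complex_of_int (seidel_matrix (m + 2) (triangle_blowup m))) z"
proof -
  define A where "A = map_mat complex_of_int (seidel_matrix (m + 2) (triangle_blowup m))"
  \<comment> \<open>Normalise to 1 on \<open>C\<close> and write \<open>x\<close>, \<open>y\<close>
    for the values at \<open>a\<close>, \<open>b\<close>. The rows of \<open>C\<close> demand
    \<open>x - y = z\<close>; adding the rows of \<open>a\<close> and \<open>b\<close> gives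
    \<open>y - x = z * (x + y)\<close>, hence \<open>x + y = -1\<close> as \<open>z\<close> is
    nonzero.\<close>
  define f where "f i = (if i < m then 1 else if i = m then (z - 1) / 2 else (- 1 - z) / 2)" for i
  define v where "v = vec (m + 2) f"
  \<comment> \<open>Eliminating \<open>m\<close> turns the rows of \<open>a\<close> and
    \<open>b\<close> into polynomial identities in \<open>z\<close>.\<close>
  have m_eq: "of_nat m = (- 1 - z * z) / 2"
    by (simp add: z flip: power2_eq_square)
  have "(\<Sum>j<m + 2. of_int (blowup_sign m i j) * f j) = z * f i" if i: "i < m + 2" for i
  proof -
    have split: "(\<Sum>j<m + 2. of_int (blowup_sign m i j) * f j) =
        of_int (\<Sum>j<m. blowup_sign m i j)
        + of_int (blowup_sign m i m) * f m + of_int (blowup_sign m i (m + 1)) * f (m + 1)"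
      by (simp add: f_def)
    consider "i < m" | "i = m" | "i = m + 1"
      using i by linarith
    then show ?thesis
    proof cases
      case 1
      then show ?thesis
        unfolding split sum_blowup_sign_regular[OF \<open>odd m\<close> 1]
        by (simp add: f_def blowup_sign_def blowup_arc_def upward_arc_def field_simps)
    next
      case 2
      then have "(\<Sum>j<m. blowup_sign m i j) = (\<Sum>j<m. - 1)"
        by (intro sum.cong) (auto simp: blowup_sign_def blowup_arc_def upward_arc_def)
      with 2 show ?thesis
        unfolding split
        by (simp add: f_def blowup_sign_def blowup_arc_def upward_arc_def m_eq field_simps)
    next
      case 3
      then have "(\<Sum>j<m. blowup_sign m i j) = (\<Sum>j<m. 1)"
        by (intro sum.cong) (auto simp: blowup_sign_def blowup_arc_def upward_arc_def)
      with 3 show ?thesis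
        unfolding split
        by (simp add: f_def blowup_sign_def blowup_arc_def upward_arc_def m_eq field_simps)
    qed
  qed
  then have "A *\<^sub>v v = z \<cdot>\<^sub>v v"
    unfolding A_def v_def seidel_matrix_triangle_blowup
    by (intro eq_vecI) (simp_all add: scalar_prod_def atLeast0LessThan)
  moreover have "v \<noteq> 0\<^sub>v (m + 2)"
  proof -
    have "0 < m"
      using \<open>odd m\<close> by (rule odd_pos)
    \<comment> \<open>Index 0 lies in \<open>C\<close>, where \<open>f\<close> is 1.\<close>
    then have "v $ 0 \<noteq> 0\<^sub>v (m + 2) $ 0"
      by (simp add: v_def f_def)
    then show ?thesis
      by metis
  qed
  ultimately have "eigenvector A v z"
    by (simp add: eigenvector_def v_def A_def seidel_matrix_def)
  then show ?thesis
    unfolding eigenvalue_def A_def by blast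
qed

theorem theorem7p6:
  fixes k :: nat
  assumes "k \<ge> 1"
  shows "\<exists>T. tournament (2 * k + 1) T \<and>
    eigenvalue (map_mat complex_of_int (seidel_matrix (2 * k + 1) T))
      (complex_of_real (sqrt (4 * real k - 1)) * \<i>) \<and>
    eigenvalue (map_mat complex_of_int (seidel_matrix (2 * k + 1) T))
      (- (complex_of_real (sqrt (4 * real k - 1)) * \<i>))"
proof -
  \<comment> \<open>The order \<open>m\<close> of \<open>C\<close> is odd, as regularity requires,
    and \<open>2 * m + 1 = 4 * k - 1\<close>; the subtraction is not truncated because
    \<open>k\<close> is positive.\<close>
  define m where "m = 2 * k - 1"
  define z where "z = complex_of_real (sqrt (4 * real k - 1)) * \<i>"
  have m: "2 * k + 1 = m + 2" "odd m"
    using assms by (auto simp: m_def)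
  have "z\<^sup>2 = - complex_of_real ((sqrt (4 * real k - 1))\<^sup>2)"
    by (simp add: z_def power_mult_distrib)
  also have "\<dots> = - complex_of_real (2 * real m + 1)"
    using assms by (simp add: m_def of_nat_diff)
  finally have z: "z\<^sup>2 = - (2 * of_nat m + 1)"
    by simp
  then have "(- z)\<^sup>2 = - (2 * of_nat m + 1)"
    by simp
  with z m(2) show ?thesis
    unfolding m(1) z_def[symmetric]
    using tournament_triangle_blowup eigenvalue_triangle_blowup by blast
qed

end
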